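(* Let $v=(v_n)_{n=1}^\infty$ and $w=(w_n)_{n=1}^\infty$ be weights with $v\approx w$, i.e. there exist $0<a\le b<\infty$ with $av_n\le w_n\le bv_n$ for all $n\in\mathbb N$. Then every basis with the $w$-Property (A) also has the $v$-Property (A).
   Context: Basis: a Schauder basis $\mathcal B=(e_n)_{n=1}^\infty$ of a real Banach space $\mathbb X$ with biorthogonal functionals $(e_n^* )_{n=1}^\infty$ such that $0<\inf_n\min\{\|e_n\|,\|e_n^*\|\}\le\sup_n\max\{\|e_n\|,\|e_n^*\|\}<\infty$. For $x\in\mathbb X$, $\mathrm{supp}(x)=\{i\in\mathbb N: e_i^*(x)\neq0\}$. $\mathbb N^{<\infty}$ is the family of finite subsets of $\mathbb N$. For signs $\varepsilon=(\varepsilon_n)$, $\varepsilon_n\in\{\pm1\}$, and finite $A$, $\mathbf 1_{\varepsilon A}=\sum_{n\in A}\varepsilon_ne_n$. A weight is a sequence $w=(w_i)_{i=1}^\infty\in(0,\infty)^{\mathbb N}$; $w(A)=\sum_{i\in A}w_i$. For a weight $w$, $\mathcal B$ has the $w$-Property (A) if there is $C\ge1$ such that $\|x+t\mathbf 1_{\varepsilon A}\|\le C\|x+t\mathbf 1_{\eta B}\|$ for all $x\in\mathbb X$, all $A,B\in\mathbb N^{<\infty}$ with $w(A)\le w(B)$, $A\cap B=\emptyset$, $\mathrm{supp}(x)\cap(A\cup B)=\emptyset$, all signs $\varepsilon,\eta$, and all $t\ge\sup_j|e_j^*(x)|$. *)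

theory Defs
  imports "HOL-Analysis.Bounded_Linear_Function"
begin

text \<open>Sequences indexed by \<open>{1, 2, \<dots>}\<close> on paper are functions on \<^typ>\<open>nat\<close>, starting at \<open>0\<close>.
  The dual of \<open>'a\<close> is \<open>'a \<Rightarrow>\<^sub>L real\<close>, whose norm is the operator norm.\<close>

definition schauder_basis :: "(nat \<Rightarrow> 'a::banach) \<Rightarrow> bool" where
  "schauder_basis e \<longleftrightarrow> (\<forall>x. \<exists>!a :: nat \<Rightarrow> real. (\<lambda>n. a n *\<^sub>R e n) sums x)"

definition biorthogonal :: "(nat \<Rightarrow> 'a::banach) \<Rightarrow> (nat \<Rightarrow> 'a \<Rightarrow>\<^sub>L real) \<Rightarrow> bool" where
  "biorthogonal e e' \<longleftrightarrow> (\<forall>m n. blinfun_apply (e' m) (e n) = (if m = n then 1 else 0))"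

text \<open>For a Schauder basis \<open>e\<close>, biorthogonality and continuity determine \<open>e'\<close> as the sequence of
  coordinate functionals. The infimum below is over a set bounded below by \<open>0\<close>, so \<open>INF\<close> is
  meaningful; finiteness of the supremum is stated as \<^const>\<open>bdd_above\<close>.\<close>

definition is_basis :: "(nat \<Rightarrow> 'a::banach) \<Rightarrow> (nat \<Rightarrow> 'a \<Rightarrow>\<^sub>L real) \<Rightarrow> bool" where
  "is_basis e e' \<longleftrightarrow>
     schauder_basis e \<and> biorthogonal e e' \<and>
     0 < (INF n. min (norm (e n)) (norm (e' n))) \<and>
     bdd_above (range (\<lambda>n. max (norm (e n)) (norm (e' n))))"

definition supp :: "(nat \<Rightarrow> 'a::banach \<Rightarrow>\<^sub>L real) \<Rightarrow> 'a \<Rightarrow> nat set" where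
  "supp e' x = {i. blinfun_apply (e' i) x \<noteq> 0}"

definition is_sign :: "(nat \<Rightarrow> real) \<Rightarrow> bool" where
  "is_sign \<epsilon> \<longleftrightarrow> (\<forall>n. \<epsilon> n \<in> {1, -1})"

definition signed_ind :: "(nat \<Rightarrow> 'a::banach) \<Rightarrow> (nat \<Rightarrow> real) \<Rightarrow> nat set \<Rightarrow> 'a" where
  "signed_ind e \<epsilon> A = (\<Sum>n\<in>A. \<epsilon> n *\<^sub>R e n)"

definition is_weight :: "(nat \<Rightarrow> real) \<Rightarrow> bool" where
  "is_weight w \<longleftrightarrow> (\<forall>n. 0 < w n)"

definition weight_equiv :: "(nat \<Rightarrow> real) \<Rightarrow> (nat \<Rightarrow> real) \<Rightarrow> bool" where
  "weight_equiv v w \<longleftrightarrow>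
     (\<exists>a b. 0 < a \<and> a \<le> b \<and> (\<forall>n. a * v n \<le> w n \<and> w n \<le> b * v n))"

text \<open>When \<open>is_basis e e'\<close> holds, the functionals are uniformly bounded, so the supremum of the
  \<open>\<bar>e' j x\<bar>\<close> is finite and \<open>SUP\<close> denotes it.\<close>

definition property_A ::
  "(nat \<Rightarrow> real) \<Rightarrow> (nat \<Rightarrow> 'a::banach) \<Rightarrow> (nat \<Rightarrow> 'a \<Rightarrow>\<^sub>L real) \<Rightarrow> bool" where
  "property_A w e e' \<longleftrightarrow>
     (\<exists>C\<ge>1. \<forall>x A B \<epsilon> \<eta> t.
        finite A \<longrightarrow> finite B \<longrightarrow> sum w A \<le> sum w B \<longrightarrow> A \<inter> B = {} \<longrightarrow>
        supp e' x \<inter> (A \<union> B) = {} \<longrightarrow> is_sign \<epsilon> \<longrightarrow> is_sign \<eta> \<longrightarrow>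
        (SUP j. \<bar>blinfun_apply (e' j) x\<bar>) \<le> t \<longrightarrow>
        norm (x + t *\<^sub>R signed_ind e \<epsilon> A) \<le> C * norm (x + t *\<^sub>R signed_ind e \<eta> B))"

end

theory Submission
  imports Defs
begin

text \<open>Write \<open>y = x + t 1\<^bsub>\<eta>B\<^esub>\<close> for the right-hand vector. If \<open>v(A) \<le> v(B)\<close> and
  \<open>a v \<le> w \<le> b v\<close>, then \<open>w(A) \<le> N w(B)\<close> for every natural number \<open>N \<ge> b/a\<close>: the
  \<open>w\<close>-Property (A) fails to apply only because \<open>A\<close> may be too heavy by a bounded factor. Cut \<open>A\<close> into at most \<open>N\<close> blocks, each
  of them a set of \<open>w\<close>-weight at most \<open>w(B)\<close> together with at most one further index
  (\<open>norm_sum_le_of_weight_blocks\<close>). On the light part of a block the \<open>w\<close>-Property (A) applies: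
  used for that part and for the empty set, it bounds both \<open>x + t 1\<^bsub>\<epsilon>A'\<^esub>\<close> and \<open>x\<close> by
  \<open>C \<parallel>y\<parallel>\<close>, hence \<open>t 1\<^bsub>\<epsilon>A'\<^esub>\<close> by \<open>2 C \<parallel>y\<parallel>\<close>. The further index may be arbitrarily heavy, so the
  property need not apply to it; but a single term \<open>t e\<^sub>n\<close> is controlled because the basis
  vectors and their functionals are uniformly bounded and \<open>\<bar>t\<bar>\<close> is the modulus of a coordinate of \<open>y\<close>
  (\<open>abs_coefficient_le_norm\<close>). Adding the blocks and \<open>x\<close> gives a constant that depends only on
  \<open>C\<close>, \<open>N\<close> and the bounds of the basis.\<close>

text \<open>The blocks are chosen greedily: if a maximal subset of weight at most \<open>W\<close> is not
  everything, any further index pushes the weight above \<open>W\<close>, so the block with that index included uses up one of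
  the \<open>N\<close> available portions of weight. Including the index is what makes the count work without
  a bound on the individual weights.\<close>

lemma norm_sum_le_of_weight_blocks:
  fixes f :: "'i \<Rightarrow> 'b::real_normed_vector" and w :: "'i \<Rightarrow> real"
  assumes "finite A" and "\<And>n. n \<in> A \<Longrightarrow> 0 < w n" and "0 \<le> W" and "0 \<le> Q"
    and "sum w A \<le> real N * W"
    and "\<And>n. n \<in> A \<Longrightarrow> norm (f n) \<le> Q"
    and "\<And>D. D \<subseteq> A \<Longrightarrow> sum w D \<le> W \<Longrightarrow> norm (sum f D) \<le> P"
  shows "norm (sum f A) \<le> real N * (P + Q)"
  using assms
proof (induction N arbitrary: A)
  case 0
  have "A = {}"
  proof (rule ccontr)
    assume "A \<noteq> {}"
    then have "0 < sum w A" using "0.prems"(1,2) by (intro sum_pos) auto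
    then show False using "0.prems"(5) by simp
  qed
  then show ?case by simp
next
  case (Suc N)
  note fin = \<open>finite A\<close>
  have P: "0 \<le> P" using Suc.prems(7)[of "{}"] \<open>0 \<le> W\<close> by simp
  let ?light = "\<lambda>D. D \<subseteq> A \<and> sum w D \<le> W"
  have "finite {D. ?light D}" using fin by simp
  moreover have "{D. ?light D} \<noteq> {}" using \<open>0 \<le> W\<close> by (auto intro!: exI[of _ "{}"])
  ultimately have "\<exists>D\<in>{D. ?light D}. \<forall>E\<in>{D. ?light D}. D \<subseteq> E \<longrightarrow> D = E"
    by (rule finite_has_maximal)
  then obtain D where D: "D \<subseteq> A" "sum w D \<le> W"
    and max: "\<forall>E. ?light E \<longrightarrow> D \<subseteq> E \<longrightarrow> D = E"
    by auto
  have finD: "finite D" using D fin finite_subset by blast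
  have boundD: "norm (sum f D) \<le> P" using Suc.prems(7) D by blast
  show ?case
  proof (cases "D = A")
    case True
    have "P \<le> P + Q + real N * (P + Q)" using P \<open>0 \<le> Q\<close> by simp
    then show ?thesis using boundD True by (simp add: algebra_simps)
  next
    case False
    then obtain n where n: "n \<in> A" "n \<notin> D" using D by blast
    define E where "E = insert n D"
    have E: "E \<subseteq> A" "finite E" using n D finD by (auto simp: E_def)
    have "D \<subseteq> E" "D \<noteq> E" using n by (auto simp: E_def)
    then have heavy: "W < sum w E" using max E(1) not_le by blast
    have "sum w (A - E) = sum w A - sum w E" using E fin by (simp add: sum_diff)
    then have "sum w (A - E) \<le> real N * W"
      using heavy Suc.prems(5) by (simp add: algebra_simps)
    then have rest: "norm (sum f (A - E)) \<le> real N * (P + Q)"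
      using Suc.prems by (intro Suc.IH) (auto simp: subset_iff)
    have "norm (sum f E) \<le> norm (f n) + norm (sum f D)"
      using n finD by (simp add: E_def norm_triangle_ineq)
    then have block: "norm (sum f E) \<le> P + Q"
      using boundD Suc.prems(6)[of n] n by linarith
    have "sum f A = sum f (A - E) + sum f E"
      using sum.subset_diff[OF E(1) fin] .
    then have "norm (sum f A) \<le> norm (sum f (A - E)) + norm (sum f E)"
      by (simp add: norm_triangle_ineq)
    then show ?thesis using rest block by (simp add: algebra_simps)
  qed
qed

lemma is_sign_abs: "is_sign \<eta> \<Longrightarrow> \<bar>\<eta> j\<bar> = 1"
  unfolding is_sign_def by (drule spec[of _ j]) auto

lemma biorthogonal_signed_ind:
  assumes "biorthogonal e e'" and "finite B" and "j \<in> B"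
  shows "blinfun_apply (e' j) (signed_ind e \<eta> B) = \<eta> j"
proof -
  have "blinfun_apply (e' j) (signed_ind e \<eta> B) = (\<Sum>n\<in>B. \<eta> n * (if j = n then 1 else 0))"
    using assms(1)
    by (simp add: signed_ind_def biorthogonal_def blinfun.sum_right blinfun.scaleR_right)
  also have "\<dots> = (\<Sum>n\<in>B. if j = n then \<eta> n else 0)" by (intro sum.cong) auto
  also have "\<dots> = \<eta> j" using assms(2,3) by simp
  finally show ?thesis .
qed

text \<open>The functional \<open>e'\<^sub>j\<close> does not see \<open>x\<close> and reads off \<open>\<plusminus>t\<close>.\<close>

lemma abs_coefficient_le_norm:
  assumes "biorthogonal e e'" and "finite B" and "j \<in> B" and "j \<notin> supp e' x" and "is_sign \<eta>"
  shows "\<bar>t\<bar> \<le> norm (e' j) * norm (x + t *\<^sub>R signed_ind e \<eta> B)"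
proof -
  have "blinfun_apply (e' j) (x + t *\<^sub>R signed_ind e \<eta> B) = t * \<eta> j"
    using assms(4) biorthogonal_signed_ind[OF assms(1-3)]
    by (simp add: supp_def blinfun.add_right blinfun.scaleR_right)
  moreover have "\<bar>\<eta> j\<bar> = 1" using assms(5) by (rule is_sign_abs)
  ultimately have "\<bar>t\<bar> = norm (blinfun_apply (e' j) (x + t *\<^sub>R signed_ind e \<eta> B))"
    by (simp add: abs_mult)
  then show ?thesis using norm_blinfun by metis
qed

lemma is_basis_bounds:
  assumes "is_basis e e'"
  obtains M where "\<And>n. norm (e n) \<le> M" and "\<And>n. norm (e' n) \<le> M"
proof -
  from assms obtain M where "\<And>n. max (norm (e n)) (norm (e' n)) \<le> M"
    unfolding is_basis_def bdd_above_def by auto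
  then show thesis using that by (meson max.bounded_iff)
qed

lemma weight_equiv_sum_le:
  assumes "weight_equiv v w" and "is_weight w"
  obtains N :: nat where "\<And>A B. sum v A \<le> sum v B \<Longrightarrow> sum w A \<le> real N * sum w B"
proof -
  from assms(1) obtain a b where ab: "0 < a" "a \<le> b"
    and vw: "\<And>n. a * v n \<le> w n" "\<And>n. w n \<le> b * v n"
    unfolding weight_equiv_def by blast
  obtain N :: nat where N: "b / a \<le> real N" using real_arch_simple by blast
  have "sum w A \<le> real N * sum w B" if le: "sum v A \<le> sum v B" for A B
  proof -
    have "sum w A \<le> b * sum v A" unfolding sum_distrib_left by (intro sum_mono vw)
    also have "\<dots> \<le> b * sum v B" using le ab by (intro mult_left_mono) auto
    also have "\<dots> = b / a * (a * sum v B)" using ab by simp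
    also have "\<dots> \<le> b / a * sum w B"
      unfolding sum_distrib_left[of a] using ab by (intro mult_left_mono sum_mono vw) auto
    also have "\<dots> \<le> real N * sum w B"
      using N assms(2) by (intro mult_right_mono sum_nonneg) (auto simp: is_weight_def less_imp_le)
    finally show ?thesis .
  qed
  then show thesis using that by blast
qed

theorem proposition3p2:
  fixes v w :: "nat \<Rightarrow> real"
    and e :: "nat \<Rightarrow> 'a::banach"
    and e' :: "nat \<Rightarrow> 'a \<Rightarrow>\<^sub>L real"
  assumes "is_weight v" and "is_weight w" and "weight_equiv v w"
    and "is_basis e e'"
    and "property_A w e e'"
  shows "property_A v e e'"
proof -
  from assms(5) obtain C where C: "1 \<le> C"
    and propA: "\<And>x A B \<epsilon> \<eta> t. finite A \<Longrightarrow> finite B \<Longrightarrow> sum w A \<le> sum w B \<Longrightarrow> A \<inter> B = {} \<Longrightarrow>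
        supp e' x \<inter> (A \<union> B) = {} \<Longrightarrow> is_sign \<epsilon> \<Longrightarrow> is_sign \<eta> \<Longrightarrow>
        (SUP j. \<bar>blinfun_apply (e' j) x\<bar>) \<le> t \<Longrightarrow>
        norm (x + t *\<^sub>R signed_ind e \<epsilon> A) \<le> C * norm (x + t *\<^sub>R signed_ind e \<eta> B)"
    unfolding property_A_def by blast
  obtain M where M: "\<And>n. norm (e n) \<le> M" "\<And>n. norm (e' n) \<le> M"
    using is_basis_bounds[OF assms(4)] by blast
  have M0: "0 \<le> M" using M(1)[of 0] norm_ge_zero order_trans by blast
  obtain N :: nat where N: "\<And>A B. sum v A \<le> sum v B \<Longrightarrow> sum w A \<le> real N * sum w B"
    using weight_equiv_sum_le[OF assms(3,2)] by blast
  have wpos: "0 < w n" "0 \<le> w n" for n using assms(2) by (auto simp: is_weight_def less_imp_le)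
  have bio: "biorthogonal e e'" using assms(4) by (simp add: is_basis_def)
  define K where "K = C + real N * (2 * C + M * M)"
  have "1 \<le> K" unfolding K_def using C M0 by (simp add: add_increasing2)
  moreover have "norm (x + t *\<^sub>R signed_ind e \<epsilon> A) \<le> K * norm (x + t *\<^sub>R signed_ind e \<eta> B)"
    if fin: "finite A" "finite B" and le: "sum v A \<le> sum v B" and disj: "A \<inter> B = {}"
      and sup: "supp e' x \<inter> (A \<union> B) = {}" and sgn: "is_sign \<epsilon>" "is_sign \<eta>"
      and t: "(SUP j. \<bar>blinfun_apply (e' j) x\<bar>) \<le> t" for x A B \<epsilon> \<eta> t
  proof -
    define y where "y = x + t *\<^sub>R signed_ind e \<eta> B"
    define f where "f n = t *\<^sub>R \<epsilon> n *\<^sub>R e n" for n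
    have f: "t *\<^sub>R signed_ind e \<epsilon> D = sum f D" for D
      by (simp add: f_def signed_ind_def scaleR_sum_right)
    have x: "norm x \<le> C * norm y"
      using propA[of "{}" B x \<epsilon> \<eta> t] fin sup sgn t wpos
      by (simp add: y_def signed_ind_def sum_nonneg Int_Un_distrib)
    have light: "norm (sum f D) \<le> 2 * C * norm y" if "D \<subseteq> A" "sum w D \<le> sum w B" for D
    proof -
      have "norm (x + t *\<^sub>R signed_ind e \<epsilon> D) \<le> C * norm y"
        unfolding y_def using that fin disj sup sgn t
        by (intro propA) (auto intro: finite_subset)
      moreover have "norm (sum f D) \<le> norm (x + t *\<^sub>R signed_ind e \<epsilon> D) + norm x"
        using norm_triangle_ineq4[of "x + sum f D" x] by (simp add: f)
      ultimately show ?thesis using x by linarith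
    qed
    have single: "norm (f n) \<le> M * M * norm y" if "n \<in> A" for n
    proof -
      \<comment> \<open>A nonempty \<open>A\<close> forces \<open>B\<close> to be nonempty, which provides a coordinate of \<open>y\<close> equal
        to \<open>\<plusminus>t\<close>.\<close>
      have "0 < sum v A" using that fin assms(1) by (intro sum_pos) (auto simp: is_weight_def)
      then have "B \<noteq> {}" using le by auto
      then obtain j where j: "j \<in> B" by blast
      then have "\<bar>t\<bar> \<le> norm (e' j) * norm y"
        unfolding y_def using sup by (intro abs_coefficient_le_norm bio fin sgn) auto
      also have "\<dots> \<le> M * norm y" by (intro mult_right_mono M) simp
      finally have "\<bar>t\<bar> * norm (e n) \<le> (M * norm y) * M"
        by (intro mult_mono M) (use M0 in auto)
      moreover have "\<bar>\<epsilon> n\<bar> = 1" using sgn(1) by (rule is_sign_abs)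
      ultimately show ?thesis by (simp add: f_def abs_mult mult_ac)
    qed
    have "norm (sum f A) \<le> real N * (2 * C * norm y + M * M * norm y)"
      using norm_sum_le_of_weight_blocks[of A w "sum w B" "M * M * norm y" N f "2 * C * norm y"]
        fin wpos M0 N[OF le] single light
      by (simp add: sum_nonneg)
    moreover have "norm (x + t *\<^sub>R signed_ind e \<epsilon> A) \<le> norm x + norm (sum f A)"
      unfolding f by (rule norm_triangle_ineq)
    ultimately have "norm (x + t *\<^sub>R signed_ind e \<epsilon> A) \<le> K * norm y"
      using x by (simp add: K_def algebra_simps)
    then show ?thesis by (simp add: y_def)
  qed
  ultimately show ?thesis unfolding property_A_def by blast
qed

end
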